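(* Let $L$ be a field, let $A$ be an $L$-algebra, and let $M$ be a left $A$-module. Let $K\subseteq L$ be a subfield. Then $M$ is an amenable module over $A$ when $A$ is viewed as a $K$-algebra if and only if $M$ is an amenable module over $A$ when $A$ is viewed as an $L$-algebra.
   Context: Algebras are associative and unital, not necessarily commutative; modules are unital left modules. If $A$ is an algebra over a field $F$, every $A$-module $M$ is an $F$-vector space via $F\to A$. If $K\subseteq L$ is a subfield, an $L$-algebra $A$ is also a $K$-algebra by restriction of scalars. Let $F$ be a field, $A$ an $F$-algebra and $M$ an $A$-module. Given $a_1,\dots,a_r\in A$ and a real $\varepsilon>0$, a non-zero finite-dimensional $F$-subspace $V\leq M$ is called $\varepsilon$-almost invariant with respect to $a_1,\dots,a_r$ if $$\dim_F(V+a_1V+\dots+a_rV)\leq (1+\varepsilon)\dim_F V.$$ The module $M$ is amenable over $A$, where $A$ is viewed as an $F$-algebra, if for every finite list $a_1,\dots,a_r\in A$ and every $\varepsilon>0$, $M$ admits an $F$-subspace that is $\varepsilon$-almost invariant with respect to $a_1,\dots,a_r$. *)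

theory Defs
  imports Complex_Main "Jordan_Normal_Form.Missing_VectorSpace" "HOL-Algebra.Subrings"
begin

text \<open>The locale \<^locale>\<open>algebra\<close> of the library is for commutative algebras, and \<^locale>\<open>Module.module\<close>
  is for modules over commutative rings; the next two locales drop commutativity of the algebra.\<close>

locale assoc_algebra = vectorspace F A + A_ring?: ring A
  for F (structure) and A (structure) +
  assumes smult_mult_left:
      "\<lbrakk> c \<in> carrier F; a \<in> carrier A; b \<in> carrier A \<rbrakk> \<Longrightarrow>
       (c \<odot>\<^bsub>A\<^esub> a) \<otimes>\<^bsub>A\<^esub> b = c \<odot>\<^bsub>A\<^esub> (a \<otimes>\<^bsub>A\<^esub> b)"
    and smult_mult_right:
      "\<lbrakk> c \<in> carrier F; a \<in> carrier A; b \<in> carrier A \<rbrakk> \<Longrightarrow>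
       a \<otimes>\<^bsub>A\<^esub> (c \<odot>\<^bsub>A\<^esub> b) = c \<odot>\<^bsub>A\<^esub> (a \<otimes>\<^bsub>A\<^esub> b)"

locale left_module = A?: ring A + M?: abelian_group M
  for A :: "('a, 'x) ring_scheme" (structure)
  and M :: "('a, 'm, 'y) module_scheme" (structure) +
  assumes act_closed:
      "\<lbrakk> a \<in> carrier A; x \<in> carrier M \<rbrakk> \<Longrightarrow> a \<odot>\<^bsub>M\<^esub> x \<in> carrier M"
    and act_l_distr:
      "\<lbrakk> a \<in> carrier A; b \<in> carrier A; x \<in> carrier M \<rbrakk> \<Longrightarrow>
       (a \<oplus>\<^bsub>A\<^esub> b) \<odot>\<^bsub>M\<^esub> x = a \<odot>\<^bsub>M\<^esub> x \<oplus>\<^bsub>M\<^esub> b \<odot>\<^bsub>M\<^esub> x"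
    and act_r_distr:
      "\<lbrakk> a \<in> carrier A; x \<in> carrier M; y \<in> carrier M \<rbrakk> \<Longrightarrow>
       a \<odot>\<^bsub>M\<^esub> (x \<oplus>\<^bsub>M\<^esub> y) = a \<odot>\<^bsub>M\<^esub> x \<oplus>\<^bsub>M\<^esub> a \<odot>\<^bsub>M\<^esub> y"
    and act_assoc:
      "\<lbrakk> a \<in> carrier A; b \<in> carrier A; x \<in> carrier M \<rbrakk> \<Longrightarrow>
       (a \<otimes>\<^bsub>A\<^esub> b) \<odot>\<^bsub>M\<^esub> x = a \<odot>\<^bsub>M\<^esub> (b \<odot>\<^bsub>M\<^esub> x)"
    and act_one:
      "x \<in> carrier M \<Longrightarrow> \<one>\<^bsub>A\<^esub> \<odot>\<^bsub>M\<^esub> x = x"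

text \<open>The vector space structure on an \<open>A\<close>-module obtained from the structure map
  \<open>c \<mapsto> c \<odot> \<one>\<close> of the ground field into \<open>A\<close>. The fields \<open>mult\<close> and \<open>one\<close> are part of the record
  type \<^type>\<open>module\<close>, but no axiom of modules mentions them.\<close>

definition underlying_space ::
    "('f, 'a, 'x) module_scheme \<Rightarrow> ('a, 'm, 'y) module_scheme \<Rightarrow> ('f, 'm) module"
  where "underlying_space A M =
    \<lparr> carrier = carrier M, mult = mult M, one = one M, zero = zero M, add = add M,
      smult = (\<lambda>c x. (c \<odot>\<^bsub>A\<^esub> \<one>\<^bsub>A\<^esub>) \<odot>\<^bsub>M\<^esub> x) \<rparr>"

text \<open>The sum \<open>V + a\<^sub>1V + \<dots> + a\<^sub>rV\<close>.\<close>

definition sum_translates :: "('a, 'm, 'y) module_scheme \<Rightarrow> 'a list \<Rightarrow> 'm set \<Rightarrow> 'm set"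
  where "sum_translates M as V = foldl (\<lambda>W a. W <+>\<^bsub>M\<^esub> (\<lambda>v. a \<odot>\<^bsub>M\<^esub> v) ` V) V as"

text \<open>Only the operations of \<open>A\<close>, \<open>M\<close> and \<open>F\<close> enter below, so the ground field can be changed
  from \<open>L\<close> to a subfield \<open>K\<close> by replacing \<open>F\<close> alone: \<open>A\<close> is viewed as a \<open>K\<close>-algebra
  by taking \<open>F = L\<lparr>carrier := K\<rparr>\<close> (see \<open>assoc_algebra_restrict_scalars\<close>).\<close>

definition almost_invariant ::
    "('f, 'z) ring_scheme \<Rightarrow> ('f, 'a, 'x) module_scheme \<Rightarrow> ('a, 'm, 'y) module_scheme \<Rightarrow>
     'a list \<Rightarrow> real \<Rightarrow> 'm set \<Rightarrow> bool"
  where "almost_invariant F A M as \<epsilon> V \<longleftrightarrow>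
    (let space_on = (\<lambda>W. (underlying_space A M) \<lparr> carrier := W \<rparr>) in
      VectorSpace.subspace F V (underlying_space A M) \<and>
      V \<noteq> {\<zero>\<^bsub>M\<^esub>} \<and>
      vectorspace.fin_dim F (space_on V) \<and>
      real (vectorspace.dim F (space_on (sum_translates M as V)))
        \<le> (1 + \<epsilon>) * real (vectorspace.dim F (space_on V)))"

definition amenable ::
    "('f, 'z) ring_scheme \<Rightarrow> ('f, 'a, 'x) module_scheme \<Rightarrow> ('a, 'm, 'y) module_scheme \<Rightarrow> bool"
  where "amenable F A M \<longleftrightarrow>
    (\<forall>as \<epsilon>. set as \<subseteq> carrier A \<longrightarrow> \<epsilon> > 0 \<longrightarrow> (\<exists>V. almost_invariant F A M as \<epsilon> V))"

lemma assoc_algebra_restrict_scalars: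
  assumes "assoc_algebra L A" and "subfield K L"
  shows "assoc_algebra (L\<lparr>carrier := K\<rparr>) A"
proof -
  interpret L: assoc_algebra L A by (fact assms(1))
  have KL: "K \<subseteq> carrier L" using assms(2) by (rule subfieldE(3))
  have fK: "field (L\<lparr>carrier := K\<rparr>)" using ring.subfield_iff(2)[OF L.R.ring_axioms assms(2)] .
  have cK: "cring (L\<lparr>carrier := K\<rparr>)" using fK by (simp add: field_def domain_def)
  have mK: "Module.module (L\<lparr>carrier := K\<rparr>) A"
    by (rule moduleI)
      (use KL cK in \<open>auto simp: subset_iff L.M.abelian_group_axioms L.smult_l_distr L.smult_r_distr
        L.smult_assoc1\<close>)
  show ?thesis
    unfolding assoc_algebra_def vectorspace_def assoc_algebra_axioms_def
    using KL by (auto simp: mK fK L.A_ring.ring_axioms L.smult_mult_left L.smult_mult_right subset_iff)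
qed

lemma vectorspace_underlying_space:
  assumes "assoc_algebra F A" and "left_module A M"
  shows "vectorspace F (underlying_space A M)"
proof -
  interpret F: assoc_algebra F A by (fact assms(1))
  interpret M: left_module A M by (fact assms(2))
  have one: "\<one>\<^bsub>A\<^esub> \<in> carrier A" by simp
  have assoc: "((c \<otimes>\<^bsub>F\<^esub> d) \<odot>\<^bsub>A\<^esub> \<one>\<^bsub>A\<^esub>) \<odot>\<^bsub>M\<^esub> x = (c \<odot>\<^bsub>A\<^esub> \<one>\<^bsub>A\<^esub>) \<odot>\<^bsub>M\<^esub> ((d \<odot>\<^bsub>A\<^esub> \<one>\<^bsub>A\<^esub>) \<odot>\<^bsub>M\<^esub> x)"
    if "c \<in> carrier F" "d \<in> carrier F" "x \<in> carrier M" for c d x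
  proof -
    have "(c \<odot>\<^bsub>A\<^esub> \<one>\<^bsub>A\<^esub>) \<otimes>\<^bsub>A\<^esub> (d \<odot>\<^bsub>A\<^esub> \<one>\<^bsub>A\<^esub>) = (c \<otimes>\<^bsub>F\<^esub> d) \<odot>\<^bsub>A\<^esub> \<one>\<^bsub>A\<^esub>"
      using that one by (simp add: F.smult_mult_left F.smult_assoc1)
    then show ?thesis
      using M.act_assoc[of "c \<odot>\<^bsub>A\<^esub> \<one>\<^bsub>A\<^esub>" "d \<odot>\<^bsub>A\<^esub> \<one>\<^bsub>A\<^esub>" x] that one by simp
  qed
  have ab: "abelian_group (underlying_space A M)"
    by (rule abelian_groupI)
      (auto simp: underlying_space_def M.M.a_ac intro: M.M.l_neg
        intro!: bexI[of _ "\<ominus>\<^bsub>M\<^esub> _"])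
  have "Module.module F (underlying_space A M)"
    by (rule moduleI)
      (use one in \<open>auto simp: F.R.cring_axioms ab[unfolded underlying_space_def] assoc
        underlying_space_def M.act_closed M.act_l_distr M.act_r_distr F.smult_l_distr M.act_one\<close>)
  then show ?thesis by (simp add: vectorspace_def F.field_axioms)
qed

end

theory Submission
  imports Defs "HOL-Real_Asymp.Real_Asymp"
begin

text \<open>
  Almost invariance of a subspace \<open>V\<close> under \<open>a\<^sub>1, \<dots>, a\<^sub>r\<close> says that some space \<open>V'\<close> of dimension at most
  \<open>(1 + \<epsilon>) dim V\<close> contains \<open>f V\<close> for the finitely many linear maps \<open>f\<close> given by \<open>1, a\<^sub>1, \<dots>, a\<^sub>r\<close>. These maps
  are linear over \<open>L\<close>, because scalars are central in \<open>A\<close>. So both implications are statements of linear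
  algebra: a pair \<open>V, V'\<close> over one of the two fields has to be turned into such a pair over the other,
  at the price of a slightly larger \<open>\<epsilon>\<close>.

  From \<open>K\<close> to \<open>L\<close> (\<open>exists_level\<close>). The obvious candidate, the \<open>L\<close>-span of \<open>V\<close>, fails, as the dimension of
  the span says little about that of \<open>V\<close>. Instead, for each \<open>\<lambda> > 0\<close> let \<open>V\<^sub>\<lambda>\<close> be an \<open>L\<close>-subspace \<open>W\<close> at which
  \<open>dim\<^sub>K (V \<inter> W) - \<lambda> dim\<^sub>L W\<close> is largest. For all but finitely many \<open>\<lambda>\<close> it is unique, and
  these subspaces form the Harder-Narasimhan filtration given by \<open>W \<mapsto> dim\<^sub>K (V \<inter> W)\<close>. They behave like the level sets \<open>{g \<ge> \<lambda>}\<close> of a function \<open>g\<close> with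
  integral \<open>dim\<^sub>K V\<close>. First, they are functorial: \<open>f V \<subseteq> V'\<close> implies \<open>f V\<^sub>\<lambda> \<subseteq> V'\<^sub>\<mu>\<close> for \<open>\<mu> < \<lambda>\<close>
  (\<open>optimal_image_subset\<close>). Second, the integral of \<open>dim\<^sub>L V\<^sub>\<lambda>\<close> over all \<open>\<lambda>\<close> is \<open>dim\<^sub>K V\<close>, here in a
  discrete form (\<open>sum_even_levels_le\<close>, \<open>sum_odd_levels_ge\<close>). As the integrals for \<open>V'\<close> and \<open>V\<close> have ratio
  at most \<open>1 + \<epsilon>\<close>, so do, up to a small error, the dimensions of the level spaces for some \<open>\<lambda>\<close>.

  From \<open>L\<close> to \<open>K\<close> (\<open>exists_spread\<close>). Bases of \<open>V\<close> and \<open>V'\<close> over \<open>L\<close> describe the maps \<open>f\<close> by finitely many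
  matrix entries in \<open>L\<close>. A field is commutative, so these entries generate a \<open>K\<close>-algebra of polynomial
  growth, and some finite-dimensional \<open>K\<close>-subspace \<open>S\<close> of \<open>L\<close> is almost invariant under them
  (\<open>exists_almost_closed_subspace\<close>). The vectors whose coordinates lie in \<open>S\<close> form the required space.
\<close>

section \<open>Finite-dimensional subspaces\<close>

definition (in vectorspace) fd_subspace :: "'c set \<Rightarrow> bool"
  where "fd_subspace W \<longleftrightarrow> VectorSpace.subspace K W V \<and> vectorspace.fin_dim K (vs W)"

definition (in vectorspace) sdim :: "'c set \<Rightarrow> nat"
  where "sdim W = vectorspace.dim K (vs W)"

context vectorspace
begin

lemma subspace_iff:
  "VectorSpace.subspace K W V \<longleftrightarrow> W \<subseteq> carrier V \<and> \<zero>\<^bsub>V\<^esub> \<in> W \<and>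
    (\<forall>x\<in>W. \<forall>y\<in>W. x \<oplus>\<^bsub>V\<^esub> y \<in> W) \<and> (\<forall>c\<in>carrier K. \<forall>x\<in>W. c \<odot>\<^bsub>V\<^esub> x \<in> W)"
  unfolding VectorSpace.subspace_def submodule_def
  using vectorspace_axioms module_axioms by auto

lemma subspace_subset: "VectorSpace.subspace K W V \<Longrightarrow> W \<subseteq> carrier V"
  unfolding subspace_iff by simp

lemma fd_subspaceD:
  assumes "fd_subspace W"
  shows "VectorSpace.subspace K W V" "submodule K W V" "W \<subseteq> carrier V" "\<zero>\<^bsub>V\<^esub> \<in> W"
  using assms subspace_iff unfolding fd_subspace_def by (auto simp: is_module)

lemma subspace_Int:
  assumes "VectorSpace.subspace K P V" "VectorSpace.subspace K Q V"
  shows "VectorSpace.subspace K (P \<inter> Q) V"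
  using assms unfolding subspace_iff by auto

lemma span_subset_subspace:
  assumes "VectorSpace.subspace K W V" "B \<subseteq> W"
  shows "span B \<subseteq> W"
  using assms by (meson is_module span_is_subset)

lemma fd_span:
  assumes "finite B" "B \<subseteq> carrier V"
  shows "fd_subspace (span B)" "sdim (span B) \<le> card B"
proof -
  have sub: "VectorSpace.subspace K (span B) V" using span_is_subspace assms(2) .
  interpret S: vectorspace K "vs (span B)" using subspace_is_vs[OF sub] .
  have own: "B \<subseteq> span B" using in_own_span assms(2) by blast
  have gen: "S.gen_set B" using span_li_not_depend(1)[OF own] sub by (simp add: is_module)
  show "fd_subspace (span B)"
    unfolding fd_subspace_def S.fin_dim_def using sub gen own assms(1) by auto
  show "sdim (span B) \<le> card B"
    unfolding sdim_def using S.gen_ge_dim[OF assms(1) _ gen] own by simp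
qed

lemma fd_subspace_basis:
  assumes "fd_subspace W"
  obtains B where "finite B" "B \<subseteq> W" "lin_indpt B" "span B = W" "card B = sdim W"
proof -
  have sub: "VectorSpace.subspace K W V" using assms fd_subspaceD by blast
  interpret S: vectorspace K "vs W" using subspace_is_vs[OF sub] .
  obtain B where B: "finite B" "S.basis B"
    using S.finite_basis_exists assms unfolding fd_subspace_def by blast
  then have "B \<subseteq> W" unfolding S.basis_def by simp
  note nd = span_li_not_depend[OF this is_module[OF sub]]
  show thesis
    using that[of B] B nd S.dim_basis[OF B] unfolding S.basis_def sdim_def by auto
qed

lemma sdim_span_indpt:
  assumes "finite B" "B \<subseteq> carrier V" "lin_indpt B"
  shows "sdim (span B) = card B"
proof -
  have sub: "VectorSpace.subspace K (span B) V" using span_is_subspace assms(2) .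
  interpret S: vectorspace K "vs (span B)" using subspace_is_vs[OF sub] .
  have own: "B \<subseteq> span B" using in_own_span assms(2) by blast
  show ?thesis
    using S.dim_basis[OF assms(1)] span_li_not_depend[OF own is_module[OF sub]] own assms(3)
    unfolding sdim_def S.basis_def by simp
qed

lemma indpt_card_le_sdim:
  assumes "fd_subspace W" "B \<subseteq> W" "lin_indpt B"
  shows "finite B" "card B \<le> sdim W"
proof -
  have sub: "VectorSpace.subspace K W V" using assms fd_subspaceD by blast
  interpret S: vectorspace K "vs W" using subspace_is_vs[OF sub] .
  have "S.fin_dim" "S.lin_indpt B" "B \<subseteq> carrier (vs W)"
    using assms span_li_not_depend(2)[OF assms(2) is_module[OF sub]]
    unfolding fd_subspace_def by auto
  then show "finite B" "card B \<le> sdim W"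
    using S.li_le_dim unfolding sdim_def by blast+
qed

lemma fd_subspace_mono:
  assumes "fd_subspace W" "VectorSpace.subspace K W' V" "W' \<subseteq> W"
  shows "fd_subspace W'" "sdim W' \<le> sdim W"
proof -
  interpret S: vectorspace K "vs W'" using subspace_is_vs[OF assms(2)] .
  have li: "S.lin_indpt B \<longleftrightarrow> lin_indpt B" if "B \<subseteq> W'" for B
    using span_li_not_depend(2)[OF that is_module[OF assms(2)]] by simp
  have "\<exists>B. finite B \<and> maximal B (\<lambda>B. B \<subseteq> carrier (vs W') \<and> S.lin_indpt B)"
  proof (rule maximal_exists)
    show "finite B \<and> card B \<le> sdim W" if "B \<subseteq> carrier (vs W') \<and> S.lin_indpt B" for B
      using indpt_card_le_sdim[OF assms(1), of B] that li assms(3) by auto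
    show "{} \<subseteq> carrier (vs W') \<and> S.lin_indpt {}" unfolding S.lin_dep_def by auto
  qed
  then obtain B where fin: "finite B"
    and max: "maximal B (\<lambda>B. B \<subseteq> carrier (vs W') \<and> S.lin_indpt B)" by blast
  then have B: "B \<subseteq> W'" "lin_indpt B" using li unfolding maximal_def by auto
  have "S.gen_set B" using S.max_li_is_gen[OF max] .
  then have span: "span B = W'" using span_li_not_depend(1)[OF B(1) is_module[OF assms(2)]] by simp
  have "B \<subseteq> carrier V" using B assms(2) unfolding subspace_iff by auto
  then show "fd_subspace W'" "sdim W' \<le> sdim W"
    using fd_span(1)[OF fin] sdim_span_indpt[OF fin] B span
      indpt_card_le_sdim(2)[OF assms(1), of B] assms(3) by auto
qed

lemma subspace_eq_if_sdim_le:
  assumes "fd_subspace W" "VectorSpace.subspace K W' V" "W' \<subseteq> W" "sdim W \<le> sdim W'"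
  shows "W' = W"
proof -
  obtain B where B: "finite B" "B \<subseteq> W'" "lin_indpt B" "span B = W'" "card B = sdim W'"
    using fd_subspace_basis[OF fd_subspace_mono(1)[OF assms(1-3)]] .
  note sub = fd_subspaceD(1)[OF assms(1)]
  interpret S: vectorspace K "vs W" using subspace_is_vs[OF sub] .
  have BW: "B \<subseteq> W" using B assms by auto
  have "S.basis B"
    using S.dim_li_is_basis[of B] B(1,3,5) BW assms(1,4) span_li_not_depend(2)[OF BW is_module[OF sub]]
    unfolding fd_subspace_def sdim_def by auto
  then show ?thesis
    using span_li_not_depend(1)[OF BW is_module[OF sub]] B(4) unfolding S.basis_def by simp
qed

lemma fd_zero: "fd_subspace {\<zero>\<^bsub>V\<^esub>}" "sdim {\<zero>\<^bsub>V\<^esub>} = 0"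
  using fd_span[of "{}"] span_empty by auto

lemma sdim_eq_0_iff:
  assumes "fd_subspace W"
  shows "sdim W = 0 \<longleftrightarrow> W = {\<zero>\<^bsub>V\<^esub>}"
  using subspace_eq_if_sdim_le[OF assms, of "{\<zero>\<^bsub>V\<^esub>}"] fd_zero fd_subspaceD[OF assms]
    fd_subspaceD(1)[OF fd_zero(1)] by auto

text \<open>The iterated sum of translates is built from the set addition of the additive group, so
  sums of subspaces are written with it from here on.\<close>

lemma set_add_eq_subspace_sum: "P <+>\<^bsub>V\<^esub> Q = subspace_sum P Q"
  unfolding set_add_def' submodule_sum_def by auto

lemma fd_sum:
  assumes "fd_subspace P" "fd_subspace Q"
  shows "fd_subspace (P <+>\<^bsub>V\<^esub> Q)"
proof -
  obtain B where B: "finite B" "B \<subseteq> P" "span B = P" using fd_subspace_basis[OF assms(1)] by metis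
  obtain C where C: "finite C" "C \<subseteq> Q" "span C = Q" using fd_subspace_basis[OF assms(2)] by metis
  have "B \<union> C \<subseteq> carrier V" using B C assms fd_subspaceD by blast
  then show ?thesis
    using fd_span(1)[of "B \<union> C"] span_union_is_sum[of B C] B C
    unfolding set_add_eq_subspace_sum by auto
qed

lemma subset_sum:
  assumes "VectorSpace.subspace K P V" "VectorSpace.subspace K Q V"
  shows "P \<subseteq> P <+>\<^bsub>V\<^esub> Q" "Q \<subseteq> P <+>\<^bsub>V\<^esub> Q"
  using in_sum_vs[OF assms] in_sum_vs[OF assms(2,1)] vsum_comm[OF assms]
  unfolding set_add_eq_subspace_sum by simp_all

lemma sum_subset:
  assumes "VectorSpace.subspace K W V" "P \<subseteq> W" "Q \<subseteq> W"
  shows "P <+>\<^bsub>V\<^esub> Q \<subseteq> W"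
  using assms unfolding set_add_def' subspace_iff by blast

end

lemma linear_mapI:
  assumes "vectorspace K X" "vectorspace K Y"
    and "\<And>x. x \<in> carrier X \<Longrightarrow> f x \<in> carrier Y"
    and "\<And>x y. x \<in> carrier X \<Longrightarrow> y \<in> carrier X \<Longrightarrow> f (x \<oplus>\<^bsub>X\<^esub> y) = f x \<oplus>\<^bsub>Y\<^esub> f y"
    and "\<And>c x. c \<in> carrier K \<Longrightarrow> x \<in> carrier X \<Longrightarrow> f (c \<odot>\<^bsub>X\<^esub> x) = c \<odot>\<^bsub>Y\<^esub> f x"
  shows "linear_map K X Y f"
proof -
  have "f \<in> LinearCombinations.module_hom K X Y"
    unfolding LinearCombinations.module_hom_def using assms(3-5) by blast
  moreover have "Module.module K X" "Module.module K Y"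
    using assms(1,2) by (simp_all add: vectorspace_def)
  ultimately have "mod_hom K X Y f" by (simp add: mod_hom_def mod_hom_axioms_def)
  with assms(1,2) show ?thesis by (rule linear_map.intro)
qed

lemma linear_map_restrict:
  assumes "linear_map K X Y f" "VectorSpace.subspace K P X" "VectorSpace.subspace K Q Y" "f ` P \<subseteq> Q"
  shows "linear_map K (X\<lparr>carrier := P\<rparr>) (Y\<lparr>carrier := Q\<rparr>) f"
proof -
  interpret f: linear_map K X Y f by fact
  have "P \<subseteq> carrier X" using f.V.subspace_subset[OF assms(2)] .
  show ?thesis
  proof (rule linear_mapI)
    show "vectorspace K (X\<lparr>carrier := P\<rparr>)" using f.V.subspace_is_vs[OF assms(2)] .
    show "vectorspace K (Y\<lparr>carrier := Q\<rparr>)" using f.W.subspace_is_vs[OF assms(3)] .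
  qed (use \<open>P \<subseteq> carrier X\<close> assms(4) in \<open>simp_all add: subset_iff image_subset_iff\<close>)
qed

lemma subspace_carrier:
  assumes "vectorspace K X"
  shows "VectorSpace.subspace K (carrier X) X"
proof -
  interpret vectorspace K X by fact
  show ?thesis unfolding subspace_iff by auto
qed

lemma fd_image:
  assumes "linear_map K X Y f" "vectorspace.fd_subspace K X P"
  shows "vectorspace.fd_subspace K Y (f ` P)"
    and "vectorspace.sdim K Y (f ` P) + vectorspace.sdim K X {x \<in> P. f x = \<zero>\<^bsub>Y\<^esub>} =
      vectorspace.sdim K X P"
proof -
  interpret f: linear_map K X Y f by fact
  note sub = f.V.fd_subspaceD(1)[OF assms(2)]
  have fd_sub: "f ` P \<subseteq> carrier Y" using f.V.fd_subspaceD(3)[OF assms(2)] by auto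
  interpret g: linear_map K "X\<lparr>carrier := P\<rparr>" Y f
    using linear_map_restrict[OF assms(1) sub subspace_carrier[OF f.W.vectorspace_axioms]]
      fd_sub by auto
  have fd: "g.V.fin_dim" using assms(2) unfolding f.V.fd_subspace_def by simp
  have im: "g.im = f ` P" and ker: "g.ker = {x \<in> P. f x = \<zero>\<^bsub>Y\<^esub>}"
    unfolding g.im_def g.ker_def by auto
  note subim = g.imT_is_subspace[unfolded im]
  interpret h: linear_map K "X\<lparr>carrier := P\<rparr>" "Y\<lparr>carrier := f ` P\<rparr>" f
    using linear_map_restrict[OF assms(1) sub subim] by auto
  have "h.W.fin_dim" using h.rank_nullity_main(2)[OF fd] by simp
  then show "f.W.fd_subspace (f ` P)"
    unfolding f.W.fd_subspace_def using subim by simp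
  show "f.W.sdim (f ` P) + f.V.sdim {x \<in> P. f x = \<zero>\<^bsub>Y\<^esub>} = f.V.sdim P"
    using g.rank_nullity[OF fd] im ker unfolding f.W.sdim_def f.V.sdim_def by simp
qed

section \<open>Dimensions under linear maps\<close>

lemma (in vectorspace) subspace_neg:
  assumes "VectorSpace.subspace K W V" "x \<in> W"
  shows "\<ominus>\<^bsub>V\<^esub> x \<in> W"
proof -
  have "\<ominus>\<^bsub>V\<^esub> x = (\<ominus>\<^bsub>K\<^esub> \<one>\<^bsub>K\<^esub>) \<odot>\<^bsub>V\<^esub> x"
    using smult_minus_1[of x] subspace_subset[OF assms(1)] assms(2) by auto
  then show ?thesis using assms unfolding subspace_iff by simp
qed

lemma direct_sum_simps:
  "carrier (direct_sum X Y) = carrier X \<times> carrier Y"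
  "\<zero>\<^bsub>direct_sum X Y\<^esub> = (\<zero>\<^bsub>X\<^esub>, \<zero>\<^bsub>Y\<^esub>)"
  "x \<oplus>\<^bsub>direct_sum X Y\<^esub> y = (fst x \<oplus>\<^bsub>X\<^esub> fst y, snd x \<oplus>\<^bsub>Y\<^esub> snd y)"
  "c \<odot>\<^bsub>direct_sum X Y\<^esub> x = (c \<odot>\<^bsub>X\<^esub> fst x, c \<odot>\<^bsub>Y\<^esub> snd x)"
  by (simp_all add: direct_sum_def)

lemma fd_Times:
  assumes "vectorspace K X" "vectorspace K Y"
    and P: "vectorspace.fd_subspace K X P" and Q: "vectorspace.fd_subspace K Y Q"
  shows "vectorspace.fd_subspace K (direct_sum X Y) (P \<times> Q)"
    and "vectorspace.sdim K (direct_sum X Y) (P \<times> Q) =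
      vectorspace.sdim K X P + vectorspace.sdim K Y Q"
proof -
  interpret X: vectorspace K X by fact
  interpret Y: vectorspace K Y by fact
  interpret D: vectorspace K "direct_sum X Y" using direct_sum_is_vs[OF assms(1,2)] .
  note P' = X.fd_subspaceD[OF P] and Q' = Y.fd_subspaceD[OF Q]
  have inl: "linear_map K X (direct_sum X Y) (\<lambda>x. (x, \<zero>\<^bsub>Y\<^esub>))"
    by (rule linear_mapI[OF assms(1) D.vectorspace_axioms]) (simp_all add: direct_sum_simps)
  have inr: "linear_map K Y (direct_sum X Y) (Pair \<zero>\<^bsub>X\<^esub>)"
    by (rule linear_mapI[OF assms(2) D.vectorspace_axioms]) (simp_all add: direct_sum_simps)
  have fst: "linear_map K (direct_sum X Y) X fst"
    by (rule linear_mapI[OF D.vectorspace_axioms assms(1)]) (auto simp: direct_sum_simps)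
  have img: "(\<lambda>x. (x, \<zero>\<^bsub>Y\<^esub>)) ` P = P \<times> {\<zero>\<^bsub>Y\<^esub>}" "Pair \<zero>\<^bsub>X\<^esub> ` Q = {\<zero>\<^bsub>X\<^esub>} \<times> Q" by auto
  have "P \<times> Q = P \<times> {\<zero>\<^bsub>Y\<^esub>} <+>\<^bsub>direct_sum X Y\<^esub> {\<zero>\<^bsub>X\<^esub>} \<times> Q"
    unfolding set_add_def' using P'(3) Q'(3) by (force simp: direct_sum_simps)
  then show fd: "D.fd_subspace (P \<times> Q)"
    using D.fd_sum[OF fd_image(1)[OF inl P] fd_image(1)[OF inr Q]] img by simp
  have 1: "fst ` (P \<times> Q) = P" using Q'(4) by force
  have 2: "{x \<in> P \<times> Q. fst x = \<zero>\<^bsub>X\<^esub>} = Pair \<zero>\<^bsub>X\<^esub> ` Q" using P'(4) by auto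
  have 3: "{y \<in> Q. (\<zero>\<^bsub>X\<^esub>, y) = \<zero>\<^bsub>direct_sum X Y\<^esub>} = {\<zero>\<^bsub>Y\<^esub>}" using Q'(4) by (auto simp: direct_sum_simps)
  show "D.sdim (P \<times> Q) = X.sdim P + Y.sdim Q"
    using fd_image(2)[OF fst fd] fd_image(2)[OF inr Q] Y.fd_zero(2) unfolding 1 2 3 by simp
qed

text \<open>The map \<open>(x, y) \<mapsto> f x + y\<close> sends \<open>P \<times> Q\<close> onto \<open>f P + Q\<close>, and its kernel is the graph of \<open>-f\<close> over
  the part of \<open>P\<close> that \<open>f\<close> sends into \<open>Q\<close>. When \<open>f\<close> is an inclusion this is the modular law for
  dimensions. In general it compares the dimension lost on passing from \<open>P\<close> to this part with the
  dimension gained on passing from \<open>Q\<close> to \<open>f P + Q\<close>: the two are equal.\<close>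

lemma sdim_sum_preimage:
  assumes f: "linear_map K X Y f"
    and P: "vectorspace.fd_subspace K X P" and Q: "vectorspace.fd_subspace K Y Q"
  shows "vectorspace.sdim K Y (f ` P <+>\<^bsub>Y\<^esub> Q) + vectorspace.sdim K X {x \<in> P. f x \<in> Q} =
      vectorspace.sdim K X P + vectorspace.sdim K Y Q"
proof -
  interpret f: linear_map K X Y f by fact
  note vs = f.V.vectorspace_axioms f.W.vectorspace_axioms
  interpret D: vectorspace K "direct_sum X Y" using direct_sum_is_vs[OF vs] .
  note P' = f.V.fd_subspaceD[OF P] and Q' = f.W.fd_subspaceD[OF Q]
  let ?g = "\<lambda>z. f (fst z) \<oplus>\<^bsub>Y\<^esub> snd z"
  have g: "linear_map K (direct_sum X Y) Y ?g"
    by (rule linear_mapI[OF D.vectorspace_axioms vs(2)])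
      (auto simp: direct_sum_simps f.W.module.M.a_ac f.W.module.smult_r_distr)
  have fst: "linear_map K (direct_sum X Y) X fst"
    by (rule linear_mapI[OF D.vectorspace_axioms vs(1)]) (auto simp: direct_sum_simps)
  note PQ = fd_Times[OF vs P Q]
  have im: "?g ` (P \<times> Q) = f ` P <+>\<^bsub>Y\<^esub> Q"
    unfolding set_add_def' by force
  let ?N = "{z \<in> P \<times> Q. ?g z = \<zero>\<^bsub>Y\<^esub>}"
  have N: "?N = (\<lambda>x. (x, \<ominus>\<^bsub>Y\<^esub> f x)) ` {x \<in> P. f x \<in> Q}"
  proof (intro equalityI subsetI)
    fix z assume "z \<in> ?N"
    then obtain x y where z: "z = (x, y)" "x \<in> P" "y \<in> Q" "f x \<oplus>\<^bsub>Y\<^esub> y = \<zero>\<^bsub>Y\<^esub>" by auto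
    then have c: "f x \<in> carrier Y" "y \<in> carrier Y" using P'(3) Q'(3) by auto
    then have fx: "f x = \<ominus>\<^bsub>Y\<^esub> y" using z(4) f.W.module.M.minus_equality by metis
    then have "f x \<in> Q" "y = \<ominus>\<^bsub>Y\<^esub> f x" using c z(3) f.W.subspace_neg[OF Q'(1)] by simp_all
    then show "z \<in> (\<lambda>x. (x, \<ominus>\<^bsub>Y\<^esub> f x)) ` {x \<in> P. f x \<in> Q}" using z(1,2) by blast
  next
    fix z assume "z \<in> (\<lambda>x. (x, \<ominus>\<^bsub>Y\<^esub> f x)) ` {x \<in> P. f x \<in> Q}"
    then show "z \<in> ?N"
      using P'(3) f.W.subspace_neg[OF Q'(1)] by (auto simp: f.W.module.M.r_neg)
  qed
  have fdN: "D.fd_subspace ?N"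
  proof (rule D.fd_subspace_mono(1)[OF PQ(1)])
    interpret g: linear_map K "direct_sum X Y" Y ?g by (rule g)
    have "?N = P \<times> Q \<inter> g.ker" using D.fd_subspaceD(3)[OF PQ(1)] unfolding g.ker_def by auto
    then show "VectorSpace.subspace K ?N (direct_sum X Y)"
      using D.subspace_Int[OF D.fd_subspaceD(1)[OF PQ(1)] g.kerT_is_subspace] by simp
  qed auto
  \<comment> \<open>The first projection is injective on the kernel, as on every graph.\<close>
  have 1: "fst ` ?N = {x \<in> P. f x \<in> Q}" unfolding N by force
  have 2: "{z \<in> ?N. fst z = \<zero>\<^bsub>X\<^esub>} = {\<zero>\<^bsub>direct_sum X Y\<^esub>}"
    using P'(4) Q'(3,4) by (auto simp: direct_sum_simps subset_iff)
  show ?thesis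
    using fd_image(2)[OF g PQ(1)] fd_image(2)[OF fst fdN] D.fd_zero(2) PQ(2)
    unfolding im 1 2 by simp
qed

section \<open>Level subspaces\<close>

lemma subspace_preimage:
  assumes "linear_map K X Y f" "VectorSpace.subspace K P X" "VectorSpace.subspace K Q Y"
  shows "VectorSpace.subspace K {x \<in> P. f x \<in> Q} X"
proof -
  interpret f: linear_map K X Y f by fact
  note P = assms(2)[unfolded f.V.subspace_iff] and Q = assms(3)[unfolded f.W.subspace_iff]
  have 1: "f (x \<oplus>\<^bsub>X\<^esub> y) \<in> Q" if "x \<in> P" "y \<in> P" "f x \<in> Q" "f y \<in> Q" for x y
    using f.T_add[of x y] that P Q by (metis subsetD)
  have 2: "f (c \<odot>\<^bsub>X\<^esub> x) \<in> Q" if "c \<in> carrier K" "x \<in> P" "f x \<in> Q" for c x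
    using f.T_smult[of c x] that P Q by (metis subsetD)
  show ?thesis
    unfolding f.V.subspace_iff using 1 2 P Q f.T0_is_0 by (simp add: subset_eq)
qed

text \<open>One additive group with the structure of a vector space over two fields, of which \<open>K\<close> has the
  smaller set of scalars. The additive group and the scalar multiplication being shared, subspaces
  and linear maps over \<open>L\<close> are at once subspaces and linear maps over \<open>K\<close>.\<close>

locale restricted_scalars = L: vectorspace L U + K: vectorspace K U
  for L :: "('l, 'z) ring_scheme" and K :: "('l, 'z) ring_scheme"
    and U :: "('l, 'm, 'y) module_scheme" +
  assumes scalars: "carrier K \<subseteq> carrier L"
begin

lemma subspace_restrict: "VectorSpace.subspace L W U \<Longrightarrow> VectorSpace.subspace K W U"
  using scalars unfolding L.subspace_iff K.subspace_iff by auto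

lemma linear_map_restrict_scalars:
  assumes "linear_map L U U f"
  shows "linear_map K U U f"
proof -
  interpret f: linear_map L U U f by fact
  show ?thesis
    by (rule linear_mapI[OF K.vectorspace_axioms K.vectorspace_axioms])
      (simp_all add: subsetD[OF scalars])
qed

lemma fd_Int:
  assumes "K.fd_subspace V" "L.fd_subspace W"
  shows "K.fd_subspace (V \<inter> W)" "K.sdim (V \<inter> W) \<le> K.sdim V"
  using K.fd_subspace_mono[OF assms(1), of "V \<inter> W"]
    K.subspace_Int[OF K.fd_subspaceD(1)[OF assms(1)] subspace_restrict[OF L.fd_subspaceD(1)[OF assms(2)]]]
  by auto

text \<open>For finite-dimensional \<open>V\<close> this is \<open>k dim\<^sub>L W - n dim\<^sub>K (V \<inter> W)\<close>, shifted by the constant \<open>n dim\<^sub>K V\<close> to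
  make it a natural number. For a generic slope \<open>k / n\<close> it has one minimizer, a member of the
  Harder-Narasimhan filtration that \<open>V\<close> induces on the \<open>L\<close>-space: the part in which, roughly, \<open>V\<close> has at
  least \<open>k / n\<close> dimensions over \<open>K\<close> for each dimension over \<open>L\<close>.\<close>

definition cost :: "'m set \<Rightarrow> nat \<Rightarrow> nat \<Rightarrow> 'm set \<Rightarrow> nat"
  where "cost V n k W = n * (K.sdim V - K.sdim (V \<inter> W)) + k * L.sdim W"

definition optimal :: "'m set \<Rightarrow> nat \<Rightarrow> nat \<Rightarrow> 'm set \<Rightarrow> bool"
  where "optimal V n k W \<longleftrightarrow> L.fd_subspace W \<and>
    (\<forall>W'. L.fd_subspace W' \<longrightarrow> cost V n k W \<le> cost V n k W')"

lemma int_cost: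
  assumes "K.fd_subspace V" "L.fd_subspace W"
  shows "int (cost V n k W) =
    int n * (int (K.sdim V) - int (K.sdim (V \<inter> W))) + int k * int (L.sdim W)"
  unfolding cost_def using fd_Int(2)[OF assms] by (simp add: of_nat_diff)

lemma optimalD:
  assumes "optimal V n k W"
  shows "L.fd_subspace W" "\<And>W'. L.fd_subspace W' \<Longrightarrow> cost V n k W \<le> cost V n k W'"
  using assms unfolding optimal_def by auto

lemma optimal_exists: "\<exists>W. optimal V n k W"
  using ex_has_least_nat[of L.fd_subspace _ "cost V n k"] L.fd_zero(1) unfolding optimal_def by metis

text \<open>A map that sends \<open>V\<close> into \<open>V'\<close> cannot send directions in which \<open>V\<close> is dense to directions in which
  \<open>V'\<close> is sparse. Let \<open>I\<close> be the part of \<open>W\<close> that \<open>f\<close> sends into \<open>W'\<close>, and let \<open>x\<close> be the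
  codimension of \<open>I\<close> in \<open>W\<close>. By optimality of \<open>W\<close>, replacing \<open>W\<close> by \<open>I\<close> loses at least \<open>k x / n\<close>
  dimensions of \<open>V \<inter> W\<close>. By optimality of \<open>W'\<close>, replacing \<open>W'\<close> by \<open>f W + W'\<close>, which is \<open>x\<close> dimensions
  larger, gains at most \<open>k' x / n\<close> dimensions of \<open>V' \<inter> W'\<close>. As \<open>f\<close> embeds what is lost into what is
  gained, \<open>k x \<le> k' x\<close>. The strict inequality between \<open>k'\<close> and \<open>k\<close> forces \<open>x = 0\<close>, whichever minimizers
  were chosen; with \<open>k' = k\<close> one would have to take the largest minimizer for \<open>W'\<close>.\<close>

lemma optimal_image_subset:
  assumes V: "K.fd_subspace V" and V': "K.fd_subspace V'"
    and f: "linear_map L U U f" and fV: "f ` V \<subseteq> V'"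
    and W: "optimal V n k W" and W': "optimal V' n k' W'" and "k' < k"
  shows "f ` W \<subseteq> W'"
proof -
  note fdW = optimalD(1)[OF W] and fdW' = optimalD(1)[OF W']
  interpret fL: linear_map L U U f by fact
  let ?I = "{x \<in> W. f x \<in> W'}" and ?S = "f ` W <+>\<^bsub>U\<^esub> W'"
  have sub_I: "VectorSpace.subspace L ?I U"
    using subspace_preimage[OF f L.fd_subspaceD(1)[OF fdW] L.fd_subspaceD(1)[OF fdW']] .
  have fdI: "L.fd_subspace ?I" and dI: "L.sdim ?I \<le> L.sdim W"
    using L.fd_subspace_mono[OF fdW sub_I] by auto
  have fdS: "L.fd_subspace ?S" using L.fd_sum[OF fd_image(1)[OF f fdW] fdW'] .
  have d: "L.sdim ?S + L.sdim ?I = L.sdim W + L.sdim W'"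
    using sdim_sum_preimage[OF f fdW fdW'] .
  let ?T = "f ` (V \<inter> W) <+>\<^bsub>U\<^esub> (V' \<inter> W')"
  note fdVW = fd_Int(1)[OF V fdW] and fdVW' = fd_Int(1)[OF V' fdW']
  note fK = linear_map_restrict_scalars[OF f]
  have "{x \<in> V \<inter> W. f x \<in> V' \<inter> W'} = V \<inter> ?I" using fV by auto
  then have e: "K.sdim ?T + K.sdim (V \<inter> ?I) = K.sdim (V \<inter> W) + K.sdim (V' \<inter> W')"
    using sdim_sum_preimage[OF fK fdVW fdVW'] by simp
  have "?T \<subseteq> V' \<inter> ?S"
  proof (rule K.sum_subset)
    show "VectorSpace.subspace K (V' \<inter> ?S) U" using K.fd_subspaceD(1)[OF fd_Int(1)[OF V' fdS]] .
    note sub = L.subset_sum[OF L.fd_subspaceD(1)[OF fd_image(1)[OF f fdW]] L.fd_subspaceD(1)[OF fdW']]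
    show "f ` (V \<inter> W) \<subseteq> V' \<inter> ?S" using sub(1) fV by auto
    show "V' \<inter> W' \<subseteq> V' \<inter> ?S" using sub(2) by auto
  qed
  then have T: "K.sdim ?T \<le> K.sdim (V' \<inter> ?S)"
    by (rule K.fd_subspace_mono(2)[OF fd_Int(1)[OF V' fdS]
      K.fd_subspaceD(1)[OF K.fd_sum[OF fd_image(1)[OF fK fdVW] fdVW']]])
  have c: "int (cost V n k W) \<le> int (cost V n k ?I)"
    using optimalD(2)[OF W fdI] by simp
  have c': "int (cost V' n k' W') \<le> int (cost V' n k' ?S)"
    using optimalD(2)[OF W' fdS] by simp
  have "L.sdim W \<le> L.sdim ?I"
  proof (rule ccontr)
    assume "\<not> L.sdim W \<le> L.sdim ?I"
    then have lt: "int (L.sdim W) - int (L.sdim ?I) > 0" by simp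
    define a b c0 d0 where "a = int (K.sdim (V \<inter> W))" and "b = int (K.sdim (V \<inter> ?I))"
      and "c0 = int (K.sdim (V' \<inter> W'))" and "d0 = int (K.sdim (V' \<inter> ?S))"
    have 1: "int k * (int (L.sdim W) - int (L.sdim ?I)) \<le> int n * (a - b)"
      using c unfolding int_cost[OF V fdW] int_cost[OF V fdI] a_def b_def
      by (simp add: algebra_simps)
    have 2: "int n * (d0 - c0) \<le> int k' * (int (L.sdim ?S) - int (L.sdim W'))"
      using c' unfolding int_cost[OF V' fdW'] int_cost[OF V' fdS] c0_def d0_def
      by (simp add: algebra_simps)
    have "a - b \<le> d0 - c0" using e T unfolding a_def b_def c0_def d0_def by simp
    then have 3: "int n * (a - b) \<le> int n * (d0 - c0)" by (simp add: mult_left_mono)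
    have "int (L.sdim ?S) - int (L.sdim W') = int (L.sdim W) - int (L.sdim ?I)" using d by simp
    then have "int k * (int (L.sdim W) - int (L.sdim ?I)) \<le> int k' * (int (L.sdim W) - int (L.sdim ?I))"
      using 1 2 3 by simp
    then show False using lt \<open>k' < k\<close> by simp
  qed
  then have "?I = W" using L.subspace_eq_if_sdim_le[OF fdW sub_I] by auto
  then show ?thesis by auto
qed

lemma cost_0:
  assumes "K.fd_subspace V"
  shows "cost V n k {\<zero>\<^bsub>U\<^esub>} = n * K.sdim V"
proof -
  have "V \<inter> {\<zero>\<^bsub>U\<^esub>} = {\<zero>\<^bsub>U\<^esub>}" using K.fd_subspaceD(4)[OF assms] by auto
  then show ?thesis unfolding cost_def by (simp add: K.fd_zero L.fd_zero)
qed

text \<open>Above slope \<open>dim\<^sub>K V\<close> no subspace does better than the zero subspace.\<close>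

lemma cost_ge:
  assumes "K.fd_subspace V" "L.fd_subspace W" "n * K.sdim V \<le> k"
  shows "n * K.sdim V \<le> cost V n k W"
proof (cases "W = {\<zero>\<^bsub>U\<^esub>}")
  case True
  then show ?thesis using cost_0[OF assms(1)] by simp
next
  case False
  then have "1 \<le> L.sdim W" using L.sdim_eq_0_iff[OF assms(2)] by simp
  then have "k \<le> k * L.sdim W" by simp
  then show ?thesis using assms(3) unfolding cost_def by linarith
qed

lemma cost_add: "cost V n (k + i) W = cost V n k W + i * L.sdim W"
  unfolding cost_def by (simp add: algebra_simps)

text \<open>The minimal cost at slope \<open>k / n\<close> is a concave function of \<open>k\<close> with slope \<open>dim\<^sub>L W\<close>, where \<open>W\<close> is a
  minimizer. It rises from \<open>0\<close> to \<open>n dim\<^sub>K V\<close>, so the sum of the dimensions of the minimizers over all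
  \<open>k\<close> is \<open>n dim\<^sub>K V\<close> up to a bounded error: a discrete form of the statement that the integral of
  \<open>dim\<^sub>L W\<close> over all slopes is \<open>dim\<^sub>K V\<close>. This lemma and the next give the two inequalities, for
  slopes in steps of two: using even numerators for the larger space and odd ones for the smaller
  makes the slopes for the larger space strictly lower.\<close>

lemma sum_even_levels_le:
  assumes V: "K.fd_subspace V" and W: "\<And>k. optimal V n (2 * k) (W k)"
  shows "2 * (\<Sum>k=1..N. L.sdim (W k)) \<le> n * K.sdim V"
proof -
  have "2 * (\<Sum>k=1..N. L.sdim (W k)) \<le> cost V n (2 * N) (W N)"
  proof (induction N)
    case (Suc N)
    have "cost V n (2 * N) (W N) \<le> cost V n (2 * N) (W (Suc N))"
      using optimalD(2)[OF W[of N] optimalD(1)[OF W]] .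
    then show ?case using Suc cost_add[of V n "2 * N" 2 "W (Suc N)"] by (simp add: add.commute)
  qed simp
  also have "\<dots> \<le> n * K.sdim V" using optimalD(2)[OF W L.fd_zero(1)] cost_0[OF V] by simp
  finally show ?thesis .
qed

text \<open>The steps up from \<open>k = 3\<close> leave out the part of the rise of the minimal cost that lies below, and
  the error term bounds it by the cost of an \<open>L\<close>-subspace \<open>E\<close> that contains all of \<open>V\<close>.\<close>

lemma sum_odd_levels_ge:
  assumes V: "K.fd_subspace V" and W: "\<And>k. optimal V n (2 * k + 1) (W k)"
    and E: "L.fd_subspace E" "V \<subseteq> E" and N: "n * K.sdim V \<le> N"
  shows "n * K.sdim V \<le> 3 * L.sdim E + 2 * (\<Sum>k=1..N. L.sdim (W k))"
proof -
  have step: "cost V n (2 * Suc k + 1) (W (Suc k)) \<le> cost V n (2 * k + 1) (W k) + 2 * L.sdim (W k)" for k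
    using optimalD(2)[OF W[of "Suc k"] optimalD(1)[OF W[of k]]] cost_add[of V n "2 * k + 1" 2 "W k"]
    by simp
  have "cost V n (2 * Suc N + 1) (W (Suc N)) \<le> 3 * L.sdim E + 2 * (\<Sum>k=1..N. L.sdim (W k))"
  proof (induction N)
    case 0
    have "cost V n 3 (W 1) \<le> cost V n 3 E" using optimalD(2)[OF W[of 1] E(1)] by simp
    moreover have "V \<inter> E = V" using E(2) by auto
    ultimately show ?case unfolding cost_def by simp
  next
    case (Suc N)
    then show ?case using step[of "Suc N"] by simp
  qed
  moreover have "n * K.sdim V \<le> cost V n (2 * Suc N + 1) (W (Suc N))"
    using cost_ge[OF V optimalD(1)[OF W]] N by simp
  ultimately show ?thesis by simp
qed

text \<open>Summed over the slopes, the dimensions of the optimal subspaces for \<open>V\<close> and for \<open>V'\<close> have nearly the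
  ratio of \<open>dim\<^sub>K V\<close> to \<open>dim\<^sub>K V'\<close>. So at some slope the ratio of the two dimensions is at least as
  favourable, up to the error from discretizing, which is absorbed in the gap between \<open>\<delta>\<close> and \<open>\<epsilon>\<close>
  once the slopes are fine enough.\<close>

lemma exists_level:
  assumes V: "K.fd_subspace V" "V \<noteq> {\<zero>\<^bsub>U\<^esub>}" and V': "K.fd_subspace V'"
    and F: "\<And>f. f \<in> F \<Longrightarrow> linear_map L U U f" "\<And>f. f \<in> F \<Longrightarrow> f ` V \<subseteq> V'"
    and small: "real (K.sdim V') \<le> (1 + \<delta>) * real (K.sdim V)" and "\<delta> < \<epsilon>" "0 < \<epsilon>"
  shows "\<exists>W. L.fd_subspace W \<and> W \<noteq> {\<zero>\<^bsub>U\<^esub>} \<and> (\<exists>W'. L.fd_subspace W' \<and>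
    (\<forall>f\<in>F. f ` W \<subseteq> W') \<and> real (L.sdim W') \<le> (1 + \<epsilon>) * real (L.sdim W))"
proof -
  obtain B where B: "finite B" "B \<subseteq> V" "K.span B = V" using K.fd_subspace_basis[OF V(1)] by metis
  define E where "E = L.span B"
  have BU: "B \<subseteq> carrier U" using B(2) K.fd_subspaceD(3)[OF V(1)] by simp
  have E: "L.fd_subspace E" using L.fd_span(1)[OF B(1) BU] E_def by simp
  have VE: "V \<subseteq> E"
    using K.span_subset_subspace[OF subspace_restrict[OF L.fd_subspaceD(1)[OF E]], of B]
      L.in_own_span[OF BU] B(3) E_def by simp
  define v where "v = real (K.sdim V)"
  have v: "v > 0" using K.sdim_eq_0_iff[OF V(1)] V(2) v_def by simp
  \<comment> \<open>The slopes are multiples of \<open>1 / n\<close>; this makes the error term \<open>3 dim\<^sub>L E\<close> small against \<open>n v\<close>.\<close>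
  obtain n :: nat where n: "3 * (1 + \<epsilon>) * real (L.sdim E) / ((\<epsilon> - \<delta>) * v) < real n"
    using reals_Archimedean2 by blast
  obtain W where W: "\<And>k. optimal V n (2 * k + 1) (W k)"
    using choice[of "\<lambda>k. optimal V n (2 * k + 1)"] optimal_exists by blast
  obtain W' where W': "\<And>k. optimal V' n (2 * k) (W' k)"
    using choice[of "\<lambda>k. optimal V' n (2 * k)"] optimal_exists by blast
  \<comment> \<open>Slopes above \<open>dim\<^sub>K V\<close> contribute nothing.\<close>
  define N where "N = n * K.sdim V"
  have "\<exists>k\<in>{1..N}. W k \<noteq> {\<zero>\<^bsub>U\<^esub>} \<and> real (L.sdim (W' k)) \<le> (1 + \<epsilon>) * real (L.sdim (W k))"
  proof (rule ccontr)
    assume neg: "\<not> ?thesis"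
    have "(1 + \<epsilon>) * real (L.sdim (W k)) \<le> real (L.sdim (W' k))" if "k \<in> {1..N}" for k
      using neg that L.fd_zero(2) by (cases "W k = {\<zero>\<^bsub>U\<^esub>}") auto
    then have "(\<Sum>k=1..N. (1 + \<epsilon>) * real (L.sdim (W k))) \<le> (\<Sum>k=1..N. real (L.sdim (W' k)))"
      by (rule sum_mono)
    then have 1: "(1 + \<epsilon>) * real (\<Sum>k=1..N. L.sdim (W k)) \<le> real (\<Sum>k=1..N. L.sdim (W' k))"
      by (simp add: sum_distrib_left)
    have "real (n * K.sdim V) \<le> real (3 * L.sdim E + 2 * (\<Sum>k=1..N. L.sdim (W k)))"
      using sum_odd_levels_ge[OF V(1) W E VE] unfolding N_def of_nat_le_iff by simp
    then have 2: "real n * v \<le> 3 * real (L.sdim E) + 2 * real (\<Sum>k=1..N. L.sdim (W k))"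
      unfolding v_def by simp
    have "real (2 * (\<Sum>k=1..N. L.sdim (W' k))) \<le> real (n * K.sdim V')"
      using sum_even_levels_le[OF V' W'] unfolding of_nat_le_iff .
    then have "2 * real (\<Sum>k=1..N. L.sdim (W' k)) \<le> real n * real (K.sdim V')" by simp
    also have "\<dots> \<le> real n * ((1 + \<delta>) * v)"
      using small unfolding v_def by (intro mult_left_mono) auto
    finally have 3: "2 * real (\<Sum>k=1..N. L.sdim (W' k)) \<le> real n * ((1 + \<delta>) * v)" .
    have "(1 + \<epsilon>) * (real n * v) \<le>
        (1 + \<epsilon>) * (3 * real (L.sdim E) + 2 * real (\<Sum>k=1..N. L.sdim (W k)))"
      using 2 \<open>0 < \<epsilon>\<close> by (intro mult_left_mono) auto
    also have "\<dots> \<le> 3 * (1 + \<epsilon>) * real (L.sdim E) + real n * ((1 + \<delta>) * v)"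
      using 1 3 by (simp add: algebra_simps)
    finally have "real n * ((\<epsilon> - \<delta>) * v) \<le> 3 * (1 + \<epsilon>) * real (L.sdim E)"
      by (simp add: algebra_simps)
    then show False using n v \<open>\<delta> < \<epsilon>\<close> by (simp add: divide_less_eq)
  qed
  then obtain k where k: "k \<in> {1..N}" "W k \<noteq> {\<zero>\<^bsub>U\<^esub>}"
    "real (L.sdim (W' k)) \<le> (1 + \<epsilon>) * real (L.sdim (W k))" by blast
  have "f ` W k \<subseteq> W' k" if "f \<in> F" for f
    using optimal_image_subset[OF V(1) V' F(1,2) W W'] that by simp
  then show ?thesis using optimalD(1)[OF W] optimalD(1)[OF W'] k(2,3) by blast
qed

end

section \<open>Almost closed subspaces of a field extension\<close>

lemma polynomial_less_exponential:
  fixes q :: real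
  assumes "q > 1"
  shows "\<exists>N. real (N + 1) ^ d < q ^ N"
proof -
  have "eventually (\<lambda>N. real (N + 1) ^ d < q ^ N) at_top"
    using assms by real_asymp
  then show ?thesis by (auto simp: eventually_sequentially)
qed

lemma (in vectorspace) finsum_in_subspace:
  assumes "VectorSpace.subspace K W V" "finite A" "\<And>x. x \<in> A \<Longrightarrow> g x \<in> W"
  shows "finsum V g A \<in> W"
  using assms(2,3)
proof (induction A rule: finite_induct)
  case empty
  then show ?case using assms(1) unfolding subspace_iff by simp
next
  case (insert x A)
  then have "g \<in> A \<rightarrow> carrier V" "g x \<in> carrier V" using subspace_subset[OF assms(1)] by auto
  then have "finsum V g (insert x A) = g x \<oplus>\<^bsub>V\<^esub> finsum V g A"
    using insert.hyps by (simp add: finsum_insert)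
  then show ?case using insert assms(1) unfolding subspace_iff by auto
qed

text \<open>Monomials in which each listed element has exponent at most \<open>N\<close>. Bounding the exponents
  separately rather than the total degree gives the number of monomials a simple bound, polynomial in \<open>N\<close>.\<close>

primrec monomials :: "('l, 'z) ring_scheme \<Rightarrow> 'l list \<Rightarrow> nat \<Rightarrow> 'l set"
  where
    "monomials L [] N = {\<one>\<^bsub>L\<^esub>}"
  | "monomials L (c # cs) N = (\<lambda>(i, p). c [^]\<^bsub>L\<^esub> i \<otimes>\<^bsub>L\<^esub> p) ` ({..N} \<times> monomials L cs N)"

lemma finite_monomials: "finite (monomials L cs N)"
  by (induction cs) auto

lemma card_monomials_le: "card (monomials L cs N) \<le> (N + 1) ^ length cs"
proof (induction cs)
  case (Cons c cs)
  have "card (monomials L (c # cs) N) \<le> card ({..N} \<times> monomials L cs N)"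
    unfolding monomials.simps by (intro card_image_le finite_cartesian_product finite_monomials) simp
  also have "\<dots> = (N + 1) * card (monomials L cs N)" by (simp add: card_cartesian_product)
  also have "\<dots> \<le> (N + 1) * (N + 1) ^ length cs" using Cons by (rule mult_le_mono2)
  finally show ?case by simp
qed simp

lemma monomials_mono: "N \<le> N' \<Longrightarrow> monomials L cs N \<subseteq> monomials L cs N'"
proof (induction cs)
  case (Cons c cs)
  then show ?case unfolding monomials.simps by (intro image_mono Sigma_mono) auto
qed simp

context cring
begin

lemma monomials_closed: "set cs \<subseteq> carrier R \<Longrightarrow> monomials R cs N \<subseteq> carrier R"
  by (induction cs) auto

lemma one_in_monomials: "set cs \<subseteq> carrier R \<Longrightarrow> \<one> \<in> monomials R cs N"
proof (induction cs)
  case (Cons c cs)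
  have "(0, \<one>) \<in> {..N} \<times> monomials R cs N" using Cons by simp
  then have "c [^] (0::nat) \<otimes> \<one> \<in> monomials R (c # cs) N"
    unfolding monomials.simps by (rule rev_image_eqI) simp
  then show ?case by simp
qed simp

lemma mult_monomials:
  assumes "set cs \<subseteq> carrier R" "c \<in> set cs" "p \<in> monomials R cs N"
  shows "c \<otimes> p \<in> monomials R cs (Suc N)"
  using assms
proof (induction cs arbitrary: p)
  case (Cons a cs)
  then obtain i q where p: "p = a [^] i \<otimes> q" "i \<le> N" "q \<in> monomials R cs N" by auto
  have cl: "a \<in> carrier R" "c \<in> carrier R" "q \<in> carrier R"
    using Cons.prems p(3) monomials_closed[of cs N] by auto
  have *: "a [^] j \<otimes> r \<in> monomials R (a # cs) (Suc N)"
    if "j \<le> Suc N" "r \<in> monomials R cs (Suc N)" for j r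
    using that by auto
  show ?case
  proof (cases "c = a")
    case True
    have "c \<otimes> p = a [^] Suc i \<otimes> q"
      unfolding p(1) True using cl by (simp add: m_ac)
    then show ?thesis using *[of "Suc i" q] p(2,3) monomials_mono[of N "Suc N" R cs] by auto
  next
    case False
    then have "c \<otimes> q \<in> monomials R cs (Suc N)" using Cons.IH Cons.prems p(3) by auto
    moreover have "c \<otimes> p = a [^] i \<otimes> (c \<otimes> q)"
      unfolding p(1) using cl by (simp add: m_ac)
    ultimately show ?thesis using *[of i "c \<otimes> q"] p(2) by simp
  qed
qed simp

end

text \<open>The field \<open>L\<close> as a space of vectors. The record serves for every subfield as the ground field, since
  multiplication in \<open>L\<close> is the scalar multiplication for all of them.\<close>

definition scalar_space :: "('l, 'z) ring_scheme \<Rightarrow> ('l, 'l) module"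
  where "scalar_space L = \<lparr>carrier = carrier L, mult = mult L, one = one L, zero = zero L,
    add = add L, smult = mult L\<rparr>"

lemma scalar_space_simps [simp]:
  "carrier (scalar_space L) = carrier L" "\<zero>\<^bsub>scalar_space L\<^esub> = \<zero>\<^bsub>L\<^esub>"
  "x \<oplus>\<^bsub>scalar_space L\<^esub> y = x \<oplus>\<^bsub>L\<^esub> y" "c \<odot>\<^bsub>scalar_space L\<^esub> x = c \<otimes>\<^bsub>L\<^esub> x"
  by (simp_all add: scalar_space_def)

lemma vectorspace_scalar_space:
  assumes "field L" "subfield k L"
  shows "vectorspace (L\<lparr>carrier := k\<rparr>) (scalar_space L)"
proof -
  interpret L: field L by fact
  have kL: "k \<subseteq> carrier L" using assms(2) by (rule subfieldE(3))
  note kL' = subsetD[OF kL]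
  have fk: "field (L\<lparr>carrier := k\<rparr>)" using L.subfield_iff(2)[OF assms(2)] .
  show ?thesis
    by (rule vs_criteria[OF fk])
      (auto simp: kL' L.m_assoc L.l_distr L.r_distr L.a_ac intro!: bexI[of _ "\<ominus>\<^bsub>L\<^esub> _"] L.r_neg)
qed

text \<open>A finitely generated commutative algebra has polynomial growth: the spans of the monomials in the elements of \<open>C\<close> with
  exponents at most \<open>N\<close> have dimension at most polynomial in \<open>N\<close>, so they cannot grow by a factor of
  more than \<open>1 + \<eta>\<close> at every step.\<close>

lemma exists_almost_closed_subspace:
  assumes L: "field L" and k: "subfield k L" and C: "finite C" "C \<subseteq> carrier L" and "\<eta> > 0"
  obtains S S' where
    "vectorspace.fd_subspace (L\<lparr>carrier := k\<rparr>) (scalar_space L) S" "S \<noteq> {\<zero>\<^bsub>L\<^esub>}"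
    "vectorspace.fd_subspace (L\<lparr>carrier := k\<rparr>) (scalar_space L) S'"
    "\<And>c s. c \<in> C \<Longrightarrow> s \<in> S \<Longrightarrow> c \<otimes>\<^bsub>L\<^esub> s \<in> S'"
    "real (vectorspace.sdim (L\<lparr>carrier := k\<rparr>) (scalar_space L) S')
      \<le> (1 + \<eta>) * real (vectorspace.sdim (L\<lparr>carrier := k\<rparr>) (scalar_space L) S)"
proof -
  interpret L: field L by fact
  have kL: "k \<subseteq> carrier L" using k by (rule subfieldE(3))
  interpret X: vectorspace "L\<lparr>carrier := k\<rparr>" "scalar_space L"
    using vectorspace_scalar_space[OF L k] .
  obtain cs where cs: "set cs = C" using finite_list[OF C(1)] by blast
  have csL: "set cs \<subseteq> carrier L" using cs C(2) by simp
  let ?m = "monomials L cs"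
  have mL: "?m N \<subseteq> carrier (scalar_space L)" for N using L.monomials_closed[OF csL] by simp
  define S where "S N = X.span (?m N)" for N
  have fd: "X.fd_subspace (S N)" and up: "X.sdim (S N) \<le> (N + 1) ^ length cs" for N
    using X.fd_span[OF finite_monomials mL, of N] le_trans[OF _ card_monomials_le] unfolding S_def by auto
  have ne: "S N \<noteq> {\<zero>\<^bsub>L\<^esub>}" for N
    using X.in_own_span[OF mL, of N] L.one_in_monomials[OF csL, of N] L.zero_not_one
    unfolding S_def by auto
  have mult: "c \<otimes>\<^bsub>L\<^esub> s \<in> S (Suc N)" if c: "c \<in> C" and s: "s \<in> S N" for c s N
  proof -
    have cL: "c \<in> carrier L" using c C(2) by auto
    have lin: "linear_map (L\<lparr>carrier := k\<rparr>) (scalar_space L) (scalar_space L) (\<lambda>x. c \<otimes>\<^bsub>L\<^esub> x)"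
      by (rule linear_mapI[OF X.vectorspace_axioms X.vectorspace_axioms])
        (simp_all add: cL L.r_distr subsetD[OF kL] L.m_lcomm)
    have "S N \<subseteq> {x \<in> carrier (scalar_space L). c \<otimes>\<^bsub>L\<^esub> x \<in> S (Suc N)}"
      unfolding S_def[of N]
    proof (rule X.span_subset_subspace[OF subspace_preimage[OF lin subspace_carrier[OF X.vectorspace_axioms]
          X.fd_subspaceD(1)[OF fd]]])
      show "?m N \<subseteq> {x \<in> carrier (scalar_space L). c \<otimes>\<^bsub>L\<^esub> x \<in> S (Suc N)}"
        using L.mult_monomials[OF csL, of c _ N] c cs mL[of N] X.in_own_span[OF mL, of "Suc N"]
        unfolding S_def by auto
    qed
    then show ?thesis using s by auto
  qed
  have "\<exists>N. real (X.sdim (S (Suc N))) \<le> (1 + \<eta>) * real (X.sdim (S N))"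
  proof (rule ccontr)
    assume neg: "\<not> ?thesis"
    have "(1 + \<eta>) ^ N \<le> real (X.sdim (S N))" for N
    proof (induction N)
      case 0
      have "X.sdim (S 0) \<noteq> 0" using X.sdim_eq_0_iff[OF fd] ne by simp
      then show ?case by simp
    next
      case (Suc N)
      have "(1 + \<eta>) ^ Suc N \<le> (1 + \<eta>) * real (X.sdim (S N))"
        using Suc \<open>\<eta> > 0\<close> by simp
      also have "\<dots> \<le> real (X.sdim (S (Suc N)))" using neg by (simp add: not_le less_imp_le)
      finally show ?case .
    qed
    moreover obtain N where "real (N + 1) ^ length cs < (1 + \<eta>) ^ N"
      using polynomial_less_exponential[of "1 + \<eta>" "length cs"] \<open>\<eta> > 0\<close> by auto
    ultimately have "real (N + 1) ^ length cs < real (X.sdim (S N))" by (meson less_le_trans)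
    moreover have "real (X.sdim (S N)) \<le> real ((N + 1) ^ length cs)" using up by (simp only: of_nat_le_iff)
    ultimately show False by (simp only: of_nat_power)
  qed
  then obtain N where N: "real (X.sdim (S (Suc N))) \<le> (1 + \<eta>) * real (X.sdim (S N))" by blast
  show thesis by (rule that[OF fd ne fd mult N])
qed

section \<open>Spreading a subspace along a basis\<close>

locale subfield_scalars = L: vectorspace L U
  for L :: "('l, 'z) ring_scheme" and U :: "('l, 'm, 'y) module_scheme" +
  fixes k :: "'l set"
  assumes subfield: "subfield k L"
begin

lemma subfield_subset: "k \<subseteq> carrier L"
  using subfield by (rule subfieldE(3))

lemma vectorspace_subfield: "vectorspace (L\<lparr>carrier := k\<rparr>) U"
proof -
  note kL = subsetD[OF subfield_subset]
  have "field (L\<lparr>carrier := k\<rparr>)" using L.R.subfield_iff(2)[OF subfield] .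
  then show ?thesis
    by (rule vs_criteria)
      (auto simp: kL L.M.a_ac L.smult_l_distr L.smult_r_distr L.smult_assoc1
        intro!: bexI[of _ "\<ominus>\<^bsub>U\<^esub> _"] L.M.r_neg)
qed

sublocale restricted_scalars L "L\<lparr>carrier := k\<rparr>" U
  using vectorspace_subfield subfield_subset L.vectorspace_axioms
  by (simp add: restricted_scalars_def restricted_scalars_axioms_def)

abbreviation X where "X \<equiv> scalar_space L"

sublocale X: vectorspace "L\<lparr>carrier := k\<rparr>" X
  using vectorspace_scalar_space[OF L.field_axioms subfield] .

lemma linear_map_scale:
  assumes "b \<in> carrier U"
  shows "linear_map (L\<lparr>carrier := k\<rparr>) X U (\<lambda>s. s \<odot>\<^bsub>U\<^esub> b)"
  by (rule linear_mapI[OF X.vectorspace_axioms K.vectorspace_axioms])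
    (simp_all add: assms L.smult_l_distr L.smult_assoc1 subsetD[OF subfield_subset])

text \<open>For finite \<open>B\<close> independent over \<open>L\<close>, these are the vectors all of whose coordinates with respect to \<open>B\<close>
  lie in the \<open>K\<close>-subspace \<open>S\<close> of \<open>L\<close>.\<close>

definition coeff_space :: "'l set \<Rightarrow> 'm set \<Rightarrow> 'm set"
  where "coeff_space S B = K.span (\<Union>b\<in>B. (\<lambda>s. s \<odot>\<^bsub>U\<^esub> b) ` S)"

lemma coeff_generators_closed:
  assumes "X.fd_subspace S" "B \<subseteq> carrier U"
  shows "(\<Union>b\<in>B. (\<lambda>s. s \<odot>\<^bsub>U\<^esub> b) ` S) \<subseteq> carrier U"
  using X.fd_subspaceD(3)[OF assms(1)] assms(2) by auto

lemma coeff_space_subset_span: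
  assumes "X.fd_subspace S" "B \<subseteq> carrier U"
  shows "coeff_space S B \<subseteq> L.span B"
proof -
  note sub = L.span_is_subspace[OF assms(2)]
  have "(\<Union>b\<in>B. (\<lambda>s. s \<odot>\<^bsub>U\<^esub> b) ` S) \<subseteq> L.span B"
  proof (intro UN_least image_subsetI)
    fix b s assume "b \<in> B" "s \<in> S"
    then have "b \<in> L.span B" "s \<in> carrier L"
      using L.in_own_span[OF assms(2)] X.fd_subspaceD(3)[OF assms(1)] by auto
    then show "s \<odot>\<^bsub>U\<^esub> b \<in> L.span B" using sub unfolding L.subspace_iff by blast
  qed
  then show ?thesis
    unfolding coeff_space_def by (rule K.span_subset_subspace[OF subspace_restrict[OF sub]])
qed

text \<open>Adjoining \<open>b\<close> to \<open>B\<close> adds the copy \<open>S b\<close> of \<open>S\<close>. It meets the space already built in \<open>0\<close> only: if \<open>s b\<close> is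
  a combination of \<open>B\<close> over \<open>L\<close> and \<open>s \<noteq> 0\<close>, dividing by \<open>s\<close> in \<open>L\<close> gives a dependence of \<open>b\<close> on \<open>B\<close>.\<close>

lemma coeff_space_basis:
  assumes S: "X.fd_subspace S" and "finite B" "B \<subseteq> carrier U" "L.lin_indpt B"
  shows "K.fd_subspace (coeff_space S B) \<and> K.sdim (coeff_space S B) = card B * X.sdim S"
  using assms(2-)
proof (induction B rule: finite_induct)
  case empty
  then show ?case using K.fd_zero K.span_empty unfolding coeff_space_def by simp
next
  case (insert b B)
  then have b: "b \<in> carrier U" and BU: "B \<subseteq> carrier U" by auto
  have li: "L.lin_indpt B" using insert.prems L.subset_li_is_li by blast
  note IH = insert.IH[OF BU li]
  let ?f = "\<lambda>s. s \<odot>\<^bsub>U\<^esub> b"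
  note lin = linear_map_scale[OF b]
  note fS = fd_image(1)[OF lin S]
  have "K.span (?f ` S) = ?f ` S"
    using K.span_subset_subspace[OF K.fd_subspaceD(1)[OF fS]] K.in_own_span[OF K.fd_subspaceD(3)[OF fS]]
    by blast
  then have eq: "coeff_space S (insert b B) = ?f ` S <+>\<^bsub>U\<^esub> coeff_space S B"
    using K.span_union_is_sum[OF K.fd_subspaceD(3)[OF fS] coeff_generators_closed[OF S BU]]
    unfolding coeff_space_def K.set_add_eq_subspace_sum by simp
  have nb: "b \<notin> L.span B"
    using L.lin_dep_iff_in_span[OF BU li b insert.hyps(2)] insert.prems(2) by simp
  have "{s \<in> S. ?f s \<in> coeff_space S B} = {\<zero>\<^bsub>X\<^esub>}"
  proof (intro equalityI subsetI)
    fix s assume s: "s \<in> {s \<in> S. ?f s \<in> coeff_space S B}"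
    then have sL: "s \<in> carrier L" using X.fd_subspaceD(3)[OF S] by auto
    have sp: "?f s \<in> L.span B" using s coeff_space_subset_span[OF S BU] by auto
    have "s = \<zero>\<^bsub>L\<^esub>"
    proof (rule ccontr)
      assume "s \<noteq> \<zero>\<^bsub>L\<^esub>"
      then have "b = inv\<^bsub>L\<^esub> s \<odot>\<^bsub>U\<^esub> ?f s" "inv\<^bsub>L\<^esub> s \<in> carrier L"
        using L.mult_inverse[OF sL b] L.inverse_exists[OF sL] by auto
      then show False
        using nb sp L.span_is_subspace[OF BU] unfolding L.subspace_iff by metis
    qed
    then show "s \<in> {\<zero>\<^bsub>X\<^esub>}" by simp
  next
    fix s assume "s \<in> {\<zero>\<^bsub>X\<^esub>}"
    then show "s \<in> {s \<in> S. ?f s \<in> coeff_space S B}"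
      using X.fd_subspaceD(4)[OF S] K.fd_subspaceD(4) IH b by auto
  qed
  then have "K.sdim (coeff_space S (insert b B)) = X.sdim S + K.sdim (coeff_space S B)"
    using sdim_sum_preimage[OF lin S] IH X.fd_zero(2) unfolding eq by fastforce
  then show ?case
    using IH K.fd_sum[OF fS] insert.hyps unfolding eq by auto
qed

lemma lincomb_mem_coeff_space:
  assumes "X.fd_subspace S" "finite B" "B \<subseteq> carrier U" "\<And>b. b \<in> B \<Longrightarrow> d b \<in> S"
  shows "L.lincomb d B \<in> coeff_space S B"
proof -
  note gen = coeff_generators_closed[OF assms(1,3)]
  show ?thesis
    unfolding L.lincomb_def coeff_space_def
    by (rule K.finsum_in_subspace[OF K.span_is_subspace[OF gen] assms(2)])
      (use K.in_own_span[OF gen] assms(4) in auto)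
qed

text \<open>Spread \<open>S\<close> along a basis of \<open>W\<close>. The matrix entries of the maps in \<open>F\<close> with respect to bases of \<open>W\<close> and
  \<open>W'\<close> are finitely many elements of \<open>L\<close>; if they multiply \<open>S\<close> into a slightly larger space \<open>S'\<close>, the
  maps send the vectors with coefficients in \<open>S\<close> to vectors with coefficients in \<open>S'\<close>.\<close>

lemma exists_spread:
  assumes W: "L.fd_subspace W" "W \<noteq> {\<zero>\<^bsub>U\<^esub>}" and W': "L.fd_subspace W'"
    and F: "finite F" "\<And>f. f \<in> F \<Longrightarrow> linear_map L U U f" "\<And>f. f \<in> F \<Longrightarrow> f ` W \<subseteq> W'"
    and small: "real (L.sdim W') \<le> (1 + \<delta>) * real (L.sdim W)" and "0 < \<delta>" "\<delta> < \<epsilon>"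
  shows "\<exists>V. K.fd_subspace V \<and> V \<noteq> {\<zero>\<^bsub>U\<^esub>} \<and> (\<exists>V'. K.fd_subspace V' \<and>
    (\<forall>f\<in>F. f ` V \<subseteq> V') \<and> real (K.sdim V') \<le> (1 + \<epsilon>) * real (K.sdim V))"
proof -
  obtain B where B: "finite B" "B \<subseteq> W" "L.lin_indpt B" "card B = L.sdim W"
    using L.fd_subspace_basis[OF W(1)] by metis
  obtain B' where B': "finite B'" "B' \<subseteq> W'" "L.lin_indpt B'" "L.span B' = W'" "card B' = L.sdim W'"
    using L.fd_subspace_basis[OF W'] by metis
  have BU: "B \<subseteq> carrier U" and BU': "B' \<subseteq> carrier U"
    using B(2) B'(2) L.fd_subspaceD(3)[OF W(1)] L.fd_subspaceD(3)[OF W'] by auto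
  have "\<exists>d. d \<in> B' \<rightarrow> carrier L \<and> L.lincomb d B' = f b" if "f \<in> F" "b \<in> B" for f b
  proof -
    have "f b \<in> L.span B'" using F(3)[OF that(1)] that(2) B(2) B'(4) by auto
    then show ?thesis using L.finite_in_span[OF B'(1) BU'] by blast
  qed
  then obtain d where d: "\<And>f b. f \<in> F \<Longrightarrow> b \<in> B \<Longrightarrow> d f b \<in> B' \<rightarrow> carrier L"
    "\<And>f b. f \<in> F \<Longrightarrow> b \<in> B \<Longrightarrow> L.lincomb (d f b) B' = f b" by metis
  define C where "C = (\<lambda>(f, b, b'). d f b b') ` (F \<times> B \<times> B')"
  have C: "finite C" "C \<subseteq> carrier L"
    unfolding C_def using F(1) B(1) B'(1) d(1) by (auto simp: Pi_iff)
  \<comment> \<open>The factor that remains when \<open>1 + \<delta>\<close> is taken out of \<open>1 + \<epsilon>\<close>.\<close>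
  define \<eta> where "\<eta> = (\<epsilon> - \<delta>) / (1 + \<delta>)"
  have \<eta>: "\<eta> > 0" "(1 + \<delta>) * (1 + \<eta>) = 1 + \<epsilon>"
    using \<open>0 < \<delta>\<close> \<open>\<delta> < \<epsilon>\<close> unfolding \<eta>_def by (auto simp: field_simps)
  obtain S S' where S: "X.fd_subspace S" "S \<noteq> {\<zero>\<^bsub>L\<^esub>}" "X.fd_subspace S'"
    "\<And>c s. c \<in> C \<Longrightarrow> s \<in> S \<Longrightarrow> c \<otimes>\<^bsub>L\<^esub> s \<in> S'" "real (X.sdim S') \<le> (1 + \<eta>) * real (X.sdim S)"
    using exists_almost_closed_subspace[OF L.field_axioms subfield C \<eta>(1)] by metis
  let ?V = "coeff_space S B" and ?V' = "coeff_space S' B'"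
  have V: "K.fd_subspace ?V" "K.sdim ?V = L.sdim W * X.sdim S"
    using coeff_space_basis[OF S(1) B(1) BU B(3)] B(4) by auto
  have V': "K.fd_subspace ?V'" "K.sdim ?V' = L.sdim W' * X.sdim S'"
    using coeff_space_basis[OF S(3) B'(1) BU' B'(3)] B'(5) by auto
  have "K.sdim ?V \<noteq> 0"
    unfolding V(2) using L.sdim_eq_0_iff[OF W(1)] W(2) X.sdim_eq_0_iff[OF S(1)] S(2) by simp
  then have ne: "?V \<noteq> {\<zero>\<^bsub>U\<^esub>}" using K.sdim_eq_0_iff[OF V(1)] by simp
  have "real (K.sdim ?V') \<le> ((1 + \<delta>) * real (L.sdim W)) * ((1 + \<eta>) * real (X.sdim S))"
    unfolding V'(2) of_nat_mult using small S(5) \<open>0 < \<delta>\<close> by (intro mult_mono) auto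
  also have "\<dots> = (1 + \<epsilon>) * real (K.sdim ?V)"
    unfolding V(2) \<eta>(2)[symmetric] by (simp add: mult_ac)
  finally have dim: "real (K.sdim ?V') \<le> (1 + \<epsilon>) * real (K.sdim ?V)" .
  have img: "f ` ?V \<subseteq> ?V'" if f: "f \<in> F" for f
  proof -
    interpret f: linear_map L U U f using F(2)[OF f] .
    have gen: "f (s \<odot>\<^bsub>U\<^esub> b) \<in> ?V'" if s: "s \<in> S" and b: "b \<in> B" for s b
    proof -
      have sL: "s \<in> carrier L" using s X.fd_subspaceD(3)[OF S(1)] by auto
      have "f (s \<odot>\<^bsub>U\<^esub> b) = s \<odot>\<^bsub>U\<^esub> L.lincomb (d f b) B'"
        using d(2)[OF f b] sL b BU by (simp add: subsetD)
      also have "\<dots> = L.lincomb (\<lambda>b'. s \<otimes>\<^bsub>L\<^esub> d f b b') B'"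
        using L.lincomb_distrib[OF BU' d(1)[OF f b] sL] .
      also have "\<dots> \<in> ?V'"
      proof (rule lincomb_mem_coeff_space[OF S(3) B'(1) BU'])
        fix b' assume b': "b' \<in> B'"
        then have c: "d f b b' \<in> C" unfolding C_def using f b by force
        then show "s \<otimes>\<^bsub>L\<^esub> d f b b' \<in> S'"
          using S(4)[OF c s] L.R.m_comm[OF sL subsetD[OF C(2) c]] by simp
      qed
      finally show ?thesis .
    qed
    have "?V \<subseteq> {x \<in> carrier U. f x \<in> ?V'}"
      unfolding coeff_space_def[of S]
    proof (rule K.span_subset_subspace[OF subspace_preimage[OF linear_map_restrict_scalars[OF F(2)[OF f]]
          subspace_carrier[OF K.vectorspace_axioms] K.fd_subspaceD(1)[OF V'(1)]]])
      show "(\<Union>b\<in>B. (\<lambda>s. s \<odot>\<^bsub>U\<^esub> b) ` S) \<subseteq> {x \<in> carrier U. f x \<in> ?V'}"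
        using gen coeff_generators_closed[OF S(1) BU] by blast
    qed
    then show ?thesis by auto
  qed
  show ?thesis using V(1) ne V'(1) img dim by blast
qed

end

section \<open>Almost invariant subspaces of modules\<close>

lemma underlying_space_simps [simp]:
  "carrier (underlying_space A M) = carrier M" "\<zero>\<^bsub>underlying_space A M\<^esub> = \<zero>\<^bsub>M\<^esub>"
  "x \<oplus>\<^bsub>underlying_space A M\<^esub> y = x \<oplus>\<^bsub>M\<^esub> y"
  "c \<odot>\<^bsub>underlying_space A M\<^esub> x = (c \<odot>\<^bsub>A\<^esub> \<one>\<^bsub>A\<^esub>) \<odot>\<^bsub>M\<^esub> x"
  by (simp_all add: underlying_space_def)

text \<open>Only the addition enters, so sums of translates in \<open>M\<close> can be computed in its underlying
  vector space.\<close>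

lemma set_add_underlying_space: "P <+>\<^bsub>M\<^esub> Q = P <+>\<^bsub>underlying_space A M\<^esub> Q"
  by (simp add: set_add_def')

text \<open>The identity is included so that the condition \<open>V \<subseteq> V'\<close> becomes one of the conditions \<open>f V \<subseteq> V'\<close>.\<close>

definition actions :: "('a, 'm, 'y) module_scheme \<Rightarrow> ('a, 'x) ring_scheme \<Rightarrow> 'a list \<Rightarrow> ('m \<Rightarrow> 'm) set"
  where "actions M A as = (\<lambda>a x. a \<odot>\<^bsub>M\<^esub> x) ` set (\<one>\<^bsub>A\<^esub> # as)"

locale algebra_module = assoc_algebra F A + left_module A M
  for F :: "('f, 'z) ring_scheme" and A :: "('f, 'a, 'x) module_scheme"
    and M :: "('a, 'm, 'y) module_scheme"
begin

abbreviation U where "U \<equiv> underlying_space A M"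

sublocale U: vectorspace F U
  by (rule vectorspace_underlying_space[OF assoc_algebra_axioms left_module_axioms])

text \<open>Linearity over the ground field is where it matters that scalars are central in the algebra.\<close>

lemma linear_map_act:
  assumes a: "a \<in> carrier A"
  shows "linear_map F U U (\<lambda>x. a \<odot>\<^bsub>M\<^esub> x)"
proof (rule linear_mapI[OF U.vectorspace_axioms U.vectorspace_axioms])
  fix c x assume c: "c \<in> carrier F" and x: "x \<in> carrier U"
  have 1: "\<one>\<^bsub>A\<^esub> \<in> carrier A" "c \<odot>\<^bsub>A\<^esub> \<one>\<^bsub>A\<^esub> \<in> carrier A" using c by simp_all
  have "a \<otimes>\<^bsub>A\<^esub> (c \<odot>\<^bsub>A\<^esub> \<one>\<^bsub>A\<^esub>) = (c \<odot>\<^bsub>A\<^esub> \<one>\<^bsub>A\<^esub>) \<otimes>\<^bsub>A\<^esub> a"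
    using smult_mult_left[OF c 1(1) a] smult_mult_right[OF c a 1(1)] a by simp
  then show "a \<odot>\<^bsub>M\<^esub> (c \<odot>\<^bsub>U\<^esub> x) = c \<odot>\<^bsub>U\<^esub> (a \<odot>\<^bsub>M\<^esub> x)"
    using act_assoc[OF a 1(2)] act_assoc[OF 1(2) a] x by simp
qed (simp_all add: a act_closed act_r_distr)

lemma sum_translates_fd:
  assumes "U.fd_subspace V" "set as \<subseteq> carrier A"
  shows "U.fd_subspace (sum_translates M as V)" "V \<subseteq> sum_translates M as V"
    "\<And>a. a \<in> set as \<Longrightarrow> (\<lambda>x. a \<odot>\<^bsub>M\<^esub> x) ` V \<subseteq> sum_translates M as V"
proof -
  have "U.fd_subspace (foldl (\<lambda>W a. W <+>\<^bsub>M\<^esub> (\<lambda>v. a \<odot>\<^bsub>M\<^esub> v) ` V) W as) \<and>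
      W \<subseteq> foldl (\<lambda>W a. W <+>\<^bsub>M\<^esub> (\<lambda>v. a \<odot>\<^bsub>M\<^esub> v) ` V) W as \<and>
      (\<forall>a\<in>set as. (\<lambda>v. a \<odot>\<^bsub>M\<^esub> v) ` V \<subseteq> foldl (\<lambda>W a. W <+>\<^bsub>M\<^esub> (\<lambda>v. a \<odot>\<^bsub>M\<^esub> v) ` V) W as)"
    if "U.fd_subspace W" for W
    using assms(2) that
  proof (induction as arbitrary: W)
    case (Cons a as)
    have fd_a: "U.fd_subspace ((\<lambda>v. a \<odot>\<^bsub>M\<^esub> v) ` V)"
      using fd_image(1)[OF linear_map_act assms(1)] Cons.prems(1) by simp
    let ?W = "W <+>\<^bsub>M\<^esub> (\<lambda>v. a \<odot>\<^bsub>M\<^esub> v) ` V"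
    have "U.fd_subspace ?W"
      unfolding set_add_underlying_space[where M = M and A = A] using U.fd_sum[OF Cons.prems(2) fd_a] .
    moreover have "W \<subseteq> ?W" "(\<lambda>v. a \<odot>\<^bsub>M\<^esub> v) ` V \<subseteq> ?W"
      unfolding set_add_underlying_space[where M = M and A = A]
      using U.subset_sum[OF U.fd_subspaceD(1)[OF Cons.prems(2)] U.fd_subspaceD(1)[OF fd_a]] .
    ultimately show ?case using Cons.IH[of ?W] Cons.prems(1) by auto
  qed simp
  from this[OF assms(1)] show "U.fd_subspace (sum_translates M as V)" "V \<subseteq> sum_translates M as V"
    "\<And>a. a \<in> set as \<Longrightarrow> (\<lambda>x. a \<odot>\<^bsub>M\<^esub> x) ` V \<subseteq> sum_translates M as V"
    unfolding sum_translates_def by auto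
qed

lemma sum_translates_subset:
  assumes "VectorSpace.subspace F W U" "V \<subseteq> W" "\<And>a. a \<in> set as \<Longrightarrow> (\<lambda>x. a \<odot>\<^bsub>M\<^esub> x) ` V \<subseteq> W"
  shows "sum_translates M as V \<subseteq> W"
proof -
  have "foldl (\<lambda>W a. W <+>\<^bsub>M\<^esub> (\<lambda>v. a \<odot>\<^bsub>M\<^esub> v) ` V) P as \<subseteq> W" if "P \<subseteq> W" for P
    using assms(3) that
  proof (induction as arbitrary: P)
    case (Cons a as)
    then show ?case
      using U.sum_subset[OF assms(1), of P "(\<lambda>v. a \<odot>\<^bsub>M\<^esub> v) ` V"]
        set_add_underlying_space[where M = M and A = A] by simp
  qed simp
  then show ?thesis using assms(2) unfolding sum_translates_def by blast
qed

lemma almost_invariant_iff: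
  "almost_invariant F A M as \<epsilon> V \<longleftrightarrow> U.fd_subspace V \<and> V \<noteq> {\<zero>\<^bsub>U\<^esub>} \<and>
    real (U.sdim (sum_translates M as V)) \<le> (1 + \<epsilon>) * real (U.sdim V)"
  unfolding almost_invariant_def Let_def U.fd_subspace_def U.sdim_def by auto

text \<open>Almost invariance in a form that mentions dimensions, linear maps and subspaces only: the sum of
  translates is the smallest choice of \<open>V'\<close>.\<close>

lemma almost_invariant_iff_actions:
  assumes as: "set as \<subseteq> carrier A"
  shows "almost_invariant F A M as \<epsilon> V \<longleftrightarrow> U.fd_subspace V \<and> V \<noteq> {\<zero>\<^bsub>U\<^esub>} \<and>
    (\<exists>V'. U.fd_subspace V' \<and> (\<forall>f\<in>actions M A as. f ` V \<subseteq> V') \<and>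
      real (U.sdim V') \<le> (1 + \<epsilon>) * real (U.sdim V))"
proof (cases "U.fd_subspace V")
  case True
  note st = sum_translates_fd[OF True as]
  have id: "(\<lambda>x. \<one>\<^bsub>A\<^esub> \<odot>\<^bsub>M\<^esub> x) ` V = V"
    using U.fd_subspaceD(3)[OF True] act_one by (force simp: subset_iff)
  have image_iff: "(\<forall>f\<in>actions M A as. f ` V \<subseteq> V') \<longleftrightarrow>
      V \<subseteq> V' \<and> (\<forall>a\<in>set as. (\<lambda>x. a \<odot>\<^bsub>M\<^esub> x) ` V \<subseteq> V')" for V'
    unfolding actions_def using id by simp
  have "U.sdim (sum_translates M as V) \<le> U.sdim V'"
    if "U.fd_subspace V'" "\<forall>f\<in>actions M A as. f ` V \<subseteq> V'" for V'
  proof -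
    have "sum_translates M as V \<subseteq> V'"
      using sum_translates_subset[OF U.fd_subspaceD(1)[OF that(1)]] that(2) unfolding image_iff by simp
    then show ?thesis
      by (rule U.fd_subspace_mono(2)[OF that(1) U.fd_subspaceD(1)[OF st(1)]])
  qed
  moreover have "\<forall>f\<in>actions M A as. f ` V \<subseteq> sum_translates M as V"
    unfolding image_iff using st(2,3) by blast
  ultimately show ?thesis
    unfolding almost_invariant_iff using True st(1) by (meson of_nat_le_iff order_trans)
qed (simp add: almost_invariant_iff)

lemma linear_map_actions:
  assumes "set as \<subseteq> carrier A" "f \<in> actions M A as"
  shows "linear_map F U U f"
  using assms linear_map_act unfolding actions_def by auto

end

section \<open>Independence of the ground field\<close>

theorem theorem1p4:
  fixes L :: "('l, 'z) ring_scheme"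
    and A :: "('l, 'a, 'x) module_scheme"
    and M :: "('a, 'm, 'y) module_scheme"
    and K :: "'l set"
  assumes "field L"
    and "assoc_algebra L A"
    and "left_module A M"
    and "subfield K L"
  shows "amenable (L\<lparr>carrier := K\<rparr>) A M \<longleftrightarrow> amenable L A M"
proof -
  interpret L: algebra_module L A M
    by (rule algebra_module.intro[OF assms(2,3)])
  interpret K: algebra_module "L\<lparr>carrier := K\<rparr>" A M
    by (rule algebra_module.intro[OF assoc_algebra_restrict_scalars[OF assms(2,4)] assms(3)])
  interpret S: subfield_scalars L "underlying_space A M" K
    by (intro subfield_scalars.intro subfield_scalars_axioms.intro L.U.vectorspace_axioms assms(4))
  show ?thesis
  proof
    assume amen: "amenable (L\<lparr>carrier := K\<rparr>) A M"
    show "amenable L A M"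
      unfolding amenable_def
    proof (intro allI impI)
      fix as and \<epsilon> :: real assume as: "set as \<subseteq> carrier A" and \<epsilon>: "\<epsilon> > 0"
      then obtain V where "almost_invariant (L\<lparr>carrier := K\<rparr>) A M as (\<epsilon> / 2) V"
        using amen unfolding amenable_def by (meson half_gt_zero)
      then obtain V' where V: "K.U.fd_subspace V" "V \<noteq> {\<zero>\<^bsub>L.U\<^esub>}" "K.U.fd_subspace V'"
        "\<And>f. f \<in> actions M A as \<Longrightarrow> f ` V \<subseteq> V'"
        "real (K.U.sdim V') \<le> (1 + \<epsilon> / 2) * real (K.U.sdim V)"
        unfolding K.almost_invariant_iff_actions[OF as] by blast
      have half: "0 < \<epsilon> / 2" "\<epsilon> / 2 < \<epsilon>" using \<epsilon> by simp_all
      show "\<exists>W. almost_invariant L A M as \<epsilon> W"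
        unfolding L.almost_invariant_iff_actions[OF as]
        by (rule S.exists_level[OF V(1,2,3) L.linear_map_actions[OF as] V(4,5) half(2) \<epsilon>])
    qed
  next
    assume amen: "amenable L A M"
    show "amenable (L\<lparr>carrier := K\<rparr>) A M"
      unfolding amenable_def
    proof (intro allI impI)
      fix as and \<epsilon> :: real assume as: "set as \<subseteq> carrier A" and \<epsilon>: "\<epsilon> > 0"
      then obtain V where "almost_invariant L A M as (\<epsilon> / 2) V"
        using amen unfolding amenable_def by (meson half_gt_zero)
      then obtain V' where V: "L.U.fd_subspace V" "V \<noteq> {\<zero>\<^bsub>L.U\<^esub>}" "L.U.fd_subspace V'"
        "\<And>f. f \<in> actions M A as \<Longrightarrow> f ` V \<subseteq> V'"
        "real (L.U.sdim V') \<le> (1 + \<epsilon> / 2) * real (L.U.sdim V)"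
        unfolding L.almost_invariant_iff_actions[OF as] by blast
      have half: "0 < \<epsilon> / 2" "\<epsilon> / 2 < \<epsilon>" using \<epsilon> by simp_all
      have fin: "finite (actions M A as)" unfolding actions_def by simp
      show "\<exists>W. almost_invariant (L\<lparr>carrier := K\<rparr>) A M as \<epsilon> W"
        unfolding K.almost_invariant_iff_actions[OF as]
        by (rule S.exists_spread[OF V(1,2,3) fin L.linear_map_actions[OF as] V(4,5) half])
    qed
  qed
qed

end
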